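(* For all $(x,v)\in T\mathbb{D}$ one has $(\sigma^*F_+)(x,v)=F_P(x,v)$; that is, the pullback of the metric $F_+$ on the upper hemisphere by the map $\sigma$ is the Finsler-Poincaré metric on the unit disc.
   Context: $\mathbb{D}=\{x=(x_1,x_2)\in\mathbb{R}^2:|x|<1\}$, with $|\cdot|$ and $\langle\cdot,\cdot\rangle$ the Euclidean norm and inner product. The Finsler-Poincaré metric on $\mathbb{D}$ is $F_P(x,v)=\dfrac{2|v|}{1-|x|^2}+\dfrac{4\langle x,v\rangle}{1-|x|^4}$. On $\mathbb{R}^3_+=\{\tilde x\in\mathbb{R}^3:\tilde x_3>0\}$ let $F_+(\tilde x,\tilde v)=\dfrac{|\tilde v|}{\tilde x_3}-\dfrac{\tilde v_3}{\tilde x_3}$ for $\tilde v\in\mathbb{R}^3$. Let $\mathbb{S}^2_+=\{x\in\mathbb{R}^3:|x|=1,\ x_3>0\}$ and let $\sigma:\mathbb{D}\to\mathbb{S}^2_+\subset\mathbb{R}^3_+$ be $\sigma(x_1,x_2)=\left(\dfrac{2x_1}{1+|x|^2},\dfrac{2x_2}{1+|x|^2},\dfrac{1-|x|^2}{1+|x|^2}\right)$. The pullback is $(\sigma^*F_+)(x,v)=F_+(\sigma(x),D\sigma_x(v))$. *)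

theory Defs
  imports "HOL-Analysis.Analysis"
begin

definition unit_disc :: "(real^2) set"
  where "unit_disc = {x. norm x < 1}"

definition upper_half_space :: "(real^3) set"
  where "upper_half_space = {y. y $ 3 > 0}"

definition upper_hemisphere :: "(real^3) set"
  where "upper_hemisphere = {y. norm y = 1 \<and> y $ 3 > 0}"

(* The metrics and the map below are total functions given by their formulas;
   they are only meaningful for base points in unit_disc, upper_half_space and
   unit_disc respectively. *)

definition finsler_poincare :: "real^2 \<Rightarrow> real^2 \<Rightarrow> real"
  where "finsler_poincare x v =
    2 * norm v / (1 - (norm x)^2) + 4 * (x \<bullet> v) / (1 - (norm x)^4)"

definition F_plus :: "real^3 \<Rightarrow> real^3 \<Rightarrow> real"
  where "F_plus y w = norm w / y $ 3 - w $ 3 / y $ 3"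

definition hemisphere_map :: "real^2 \<Rightarrow> real^3"
  where "hemisphere_map x = vector
    [2 * x $ 1 / (1 + (norm x)^2),
     2 * x $ 2 / (1 + (norm x)^2),
     (1 - (norm x)^2) / (1 + (norm x)^2)]"

definition pullback_metric ::
  "('a::real_normed_vector \<Rightarrow> 'b::real_normed_vector) \<Rightarrow> ('b \<Rightarrow> 'b \<Rightarrow> real) \<Rightarrow> 'a \<Rightarrow> 'a \<Rightarrow> real"
  where "pullback_metric f F x v = F (f x) (frechet_derivative f (at x) v)"

lemma upper_hemisphere_subset: "upper_hemisphere \<subseteq> upper_half_space"
  by (auto simp: upper_hemisphere_def upper_half_space_def)

lemma hemisphere_map_in_upper_hemisphere:
  assumes "x \<in> unit_disc"
  shows "hemisphere_map x \<in> upper_hemisphere"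
proof -
  define r where "r = (norm x)^2"
  have r: "r = (x $ 1)^2 + (x $ 2)^2"
    by (simp add: r_def norm_vec_def L2_set_def sum_2)
  have r0: "r \<ge> 0" by (simp add: r_def)
  have r1: "r < 1"
    using assms by (simp add: r_def unit_disc_def power_less_one_iff abs_square_less_1)
  have "(2 * x $ 1 / (1 + r))^2 + (2 * x $ 2 / (1 + r))^2 + ((1 - r) / (1 + r))^2
      = (4 * ((x $ 1)^2 + (x $ 2)^2) + (1 - r)^2) / (1 + r)^2"
    by (simp add: power_divide power_mult_distrib add_divide_distrib algebra_simps)
  also have "\<dots> = (1 + r)^2 / (1 + r)^2"
    unfolding r[symmetric] by (simp add: power2_eq_square algebra_simps)
  also have "\<dots> = 1" using r0 by simp
  finally have "norm (hemisphere_map x) = 1"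
    by (simp add: norm_vec_def L2_set_def sum_3 hemisphere_map_def vector_3 r_def)
  moreover have "hemisphere_map x $ 3 > 0"
    using r0 r1 by (simp add: hemisphere_map_def vector_3 flip: r_def)
  ultimately show ?thesis by (simp add: upper_hemisphere_def)
qed

lemma hemisphere_map_differentiable: "hemisphere_map differentiable (at x)"
proof -
  have nz: "1 + (norm x)^2 \<noteq> 0"
    by (metis add_pos_nonneg less_irrefl zero_le_power2 zero_less_one)
  have nsq: "(\<lambda>x::real^2. (norm x)^2) differentiable (at x)"
    unfolding power2_norm_eq_inner by (intro differentiable_inner differentiable_ident)
  have comp: "(\<lambda>x::real^2. x $ i) differentiable (at x)" for i
    by (intro linear_imp_differentiable bounded_linear.linear bounded_linear_vec_nth)
  have eq: "hemisphere_map = (\<lambda>x. (2 * x $ 1 / (1 + (norm x)^2)) *\<^sub>R axis 1 1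
      + (2 * x $ 2 / (1 + (norm x)^2)) *\<^sub>R axis 2 1
      + ((1 - (norm x)^2) / (1 + (norm x)^2)) *\<^sub>R axis 3 1)"
    by (rule ext) (simp add: vec_eq_iff forall_3 hemisphere_map_def vector_3 axis_def)
  show ?thesis unfolding eq
    by (intro differentiable_add differentiable_scaleR differentiable_divide
        differentiable_mult differentiable_diff differentiable_const nsq comp nz)
qed

end

theory Submission
  imports Defs
begin

text \<open>The inverse stereographic projection \<open>\<sigma>\<close> is conformal with factor
  \<open>2 / (1 + |x|\<^sup>2)\<close>, and the height of \<open>\<sigma> x\<close> is \<open>(1 - |x|\<^sup>2) / (1 + |x|\<^sup>2)\<close>. Hence the
  Riemannian part of \<open>F\<^sub>+\<close> pulls back to the Poincare norm \<open>2 |v| / (1 - |x|\<^sup>2)\<close>, while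
  the one-form \<open>- d log y\<^sub>3\<close> pulls back to \<open>4 \<langle>x, v\<rangle> / (1 - |x|\<^sup>4)\<close>.\<close>

lemma one_plus_inner_self_pos: "1 + x \<bullet> x > 0" for x :: "'a::real_inner"
  by (simp add: add_pos_nonneg)

text \<open>The explicit candidate for the differential of \<sigma> at \<open>x\<close>. Writing
  \<open>x \<bullet> x\<close> for the squared norm lets the derivative rules for inner products
  apply directly.\<close>

definition hemisphere_map_derivative :: "real^2 \<Rightarrow> real^2 \<Rightarrow> real^3"
  where "hemisphere_map_derivative x v = vector
    [2 * v $ 1 / (1 + x \<bullet> x) - 4 * x $ 1 * (x \<bullet> v) / (1 + x \<bullet> x)\<^sup>2,
     2 * v $ 2 / (1 + x \<bullet> x) - 4 * x $ 2 * (x \<bullet> v) / (1 + x \<bullet> x)\<^sup>2,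
     - 4 * (x \<bullet> v) / (1 + x \<bullet> x)\<^sup>2]"

text \<open>The quotient rule for the denominator shared by all three coordinates of
  \<sigma>.\<close>

lemma has_derivative_divide_one_plus_inner_self:
  fixes f :: "'a::real_inner \<Rightarrow> real"
  assumes "(f has_derivative f') (at x)"
  shows "((\<lambda>y. f y / (1 + y \<bullet> y)) has_derivative
    (\<lambda>v. f' v / (1 + x \<bullet> x) - 2 * f x * (x \<bullet> v) / (1 + x \<bullet> x)\<^sup>2)) (at x)"
proof -
  have q: "1 + x \<bullet> x \<noteq> 0"
    using one_plus_inner_self_pos[of x] by simp
  have "((\<lambda>y. 1 + y \<bullet> y) has_derivative (\<lambda>v. 2 * (x \<bullet> v))) (at x)"
    by (auto intro!: derivative_eq_intros simp: inner_commute)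
  from has_derivative_divide'[OF assms this q] show ?thesis
    by (rule has_derivative_eq_rhs)
      (use q in \<open>simp add: fun_eq_iff diff_divide_distrib power2_eq_square ac_simps\<close>)
qed

lemma has_derivative_hemisphere_map:
  "(hemisphere_map has_derivative hemisphere_map_derivative x) (at x)"
proof -
  have horizontal: "((\<lambda>y. 2 * y $ i / (1 + y \<bullet> y)) has_derivative
      (\<lambda>v. 2 * v $ i / (1 + x \<bullet> x) - 4 * x $ i * (x \<bullet> v) / (1 + x \<bullet> x)\<^sup>2)) (at x)"
    for i
  proof -
    have "((\<lambda>y. 2 * y $ i) has_derivative (\<lambda>v. 2 * v $ i)) (at x)"
      by (intro has_derivative_mult_right bounded_linear_imp_has_derivative
          bounded_linear_vec_nth)
    from has_derivative_divide_one_plus_inner_self[OF this] show ?thesis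
      by simp
  qed
  have vertical: "((\<lambda>y. (1 - y \<bullet> y) / (1 + y \<bullet> y)) has_derivative
      (\<lambda>v. - 4 * (x \<bullet> v) / (1 + x \<bullet> x)\<^sup>2)) (at x)"
  proof -
    \<comment> \<open>The height equals \<open>2 / (1 + y \<bullet> y) - 1\<close>, so the quotient
      rule is needed only for a constant numerator.\<close>
    have "((\<lambda>y. 2) has_derivative (\<lambda>v. 0)) (at x)"
      by (rule has_derivative_const)
    from has_derivative_diff[OF has_derivative_divide_one_plus_inner_self[OF this]
        has_derivative_const[of 1]]
    have "((\<lambda>y. 2 / (1 + y \<bullet> y) - 1) has_derivative
        (\<lambda>v. - 4 * (x \<bullet> v) / (1 + x \<bullet> x)\<^sup>2)) (at x)"
      by simp
    moreover have "2 / (1 + y \<bullet> y) - 1 = (1 - y \<bullet> y) / (1 + y \<bullet> y)" for y :: "real^2"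
      using one_plus_inner_self_pos[of y] by (simp add: field_simps)
    ultimately show ?thesis
      by simp
  qed
  have comp: "((\<lambda>y. hemisphere_map y $ i) has_derivative
      (\<lambda>v. hemisphere_map_derivative x v $ i)) (at x)" for i
    using exhaust_3[of i] horizontal[of 1] horizontal[of 2] vertical
    by (auto simp: hemisphere_map_def hemisphere_map_derivative_def vector_3
        power2_norm_eq_inner)
  show ?thesis
    by (subst has_derivative_componentwise_within)
      (use comp in \<open>auto simp: Basis_vec_def inner_axis\<close>)
qed

text \<open>Conformality of \<sigma>: in the squared norm every term containing
  \<open>x \<bullet> v\<close> cancels.\<close>

lemma norm_hemisphere_map_derivative:
  "norm (hemisphere_map_derivative x v) = 2 * norm v / (1 + x \<bullet> x)"
proof -
  define q where "q = 1 + x \<bullet> x"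
  define s where "s = x \<bullet> v"
  define a b where "a = 2 / q" and "b = 4 * s / q\<^sup>2"
  have q: "q > 0"
    unfolding q_def by (rule one_plus_inner_self_pos)
  have xx: "(x $ 1)\<^sup>2 + (x $ 2)\<^sup>2 = q - 1" and s: "x $ 1 * v $ 1 + x $ 2 * v $ 2 = s"
    and vv: "(v $ 1)\<^sup>2 + (v $ 2)\<^sup>2 = (norm v)\<^sup>2"
    unfolding q_def s_def power2_norm_eq_inner
    by (simp_all add: inner_vec_def sum_2 power2_eq_square)
  have "hemisphere_map_derivative x v $ 1 = a * v $ 1 - b * x $ 1"
    "hemisphere_map_derivative x v $ 2 = a * v $ 2 - b * x $ 2"
    "hemisphere_map_derivative x v $ 3 = - b"
    by (simp_all add: hemisphere_map_derivative_def vector_3 a_def b_def flip: q_def s_def)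
  then have "(norm (hemisphere_map_derivative x v))\<^sup>2
      = (a * v $ 1 - b * x $ 1)\<^sup>2 + (a * v $ 2 - b * x $ 2)\<^sup>2 + b\<^sup>2"
    unfolding power2_norm_eq_inner by (simp add: inner_vec_def sum_3 power2_eq_square)
  \<comment> \<open>The vertical component supplies the summand 1 that completes |x|^2 to
    \<open>q\<close>.\<close>
  also have "\<dots> = a\<^sup>2 * ((v $ 1)\<^sup>2 + (v $ 2)\<^sup>2)
      - 2 * a * b * (x $ 1 * v $ 1 + x $ 2 * v $ 2) + b\<^sup>2 * ((x $ 1)\<^sup>2 + (x $ 2)\<^sup>2 + 1)"
    by algebra
  also have "\<dots> = a\<^sup>2 * (norm v)\<^sup>2 - 2 * a * b * s + b\<^sup>2 * q"
    by (simp only: xx s vv) simp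
  \<comment> \<open>Both \<open>2 * a * b * s\<close> and \<open>b\<^sup>2 * q\<close> equal 16 s^2
    / q^3.\<close>
  also have "\<dots> = (2 * norm v / q)\<^sup>2"
    using q by (simp add: a_def b_def field_simps power2_eq_square)
  finally show ?thesis
    using q by (simp add: q_def)
qed

theorem proposition3p6:
  fixes x v :: "real^2"
  assumes "x \<in> unit_disc"
  shows "pullback_metric hemisphere_map F_plus x v = finsler_poincare x v"
proof -
  define r where "r = (norm x)\<^sup>2"
  have r: "r \<ge> 0" "r < 1"
    using assms by (simp_all add: r_def unit_disc_def abs_square_less_1)
  have r_inner: "x \<bullet> x = r"
    by (simp add: r_def power2_norm_eq_inner)
  have height: "hemisphere_map x $ 3 = (1 - r) / (1 + r)"
    by (simp add: hemisphere_map_def vector_3 r_def)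
  \<comment> \<open>\<open>frechet_derivative\<close> chooses some derivative; uniqueness identifies
    it with the explicit one.\<close>
  have "frechet_derivative hemisphere_map (at x) = hemisphere_map_derivative x"
    by (rule frechet_derivative_at[symmetric]) (rule has_derivative_hemisphere_map)
  then have "pullback_metric hemisphere_map F_plus x v
      = 2 * norm v / (1 + r) / ((1 - r) / (1 + r))
        - (- 4 * (x \<bullet> v) / (1 + r)\<^sup>2) / ((1 - r) / (1 + r))"
    unfolding pullback_metric_def F_plus_def
    by (simp only: height norm_hemisphere_map_derivative r_inner)
      (simp add: hemisphere_map_derivative_def vector_3 r_inner)
  \<comment> \<open>Since 0 \<le> r < 1, both 1 + r and 1 - r are nonzero, and dividing by the
    height cancels one factor 1 + r in each term.\<close>
  also have "\<dots> = 2 * norm v / (1 - r) + 4 * (x \<bullet> v) / ((1 + r) * (1 - r))"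
    using r by (simp add: power2_eq_square)
  also have "(1 + r) * (1 - r) = 1 - (norm x) ^ 4"
    by (simp add: r_def algebra_simps flip: power_add)
  finally show ?thesis
    by (simp add: finsler_poincare_def r_def)
qed

end
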